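(* For $R,T\ge 0$ consider the normalized map $\Psi_{1,1;R,T}:M_3(\mathbb C)\to M_3(\mathbb C)$. In the first quadrant of the $(R,T)$-plane, the set of parameters for which $\Psi_{1,1;R,T}$ is positive is exactly the unit square \[ 0\le R\le 1,\qquad 0\le T\le 1; \] the set of parameters for which it is decomposable is exactly the quarter disk \[ R^2+T^2\le 1; \] and for every $(R,T)$ in the complementary part of the positivity square (i.e. $0\le R,T\le1$, $R^2+T^2>1$) the map is atomic. The edge $T=0$ of the square consists exactly of the completely positive maps in this family, while the edge $R=0$ consists exactly of the completely copositive maps in this family.
   Context: For $R,T\ge0$, \[ \Psi_{1,1;R,T}(X)=\begin{pmatrix} x_{11}+x_{22}&0&R x_{13}\\ 0&x_{11}+x_{22}&T x_{32}\\ R x_{31}&T x_{23}&x_{33}\end{pmatrix},\qquad X=(x_{ij})\in M_3(\mathbb C). \] These are the normalizations, with $R=r/\sqrt{pq}$ and $T=t/\sqrt{pq}$, of the maps \[ \Psi_{p,q;r,t}(X)=\begin{pmatrix} p(x_{11}+x_{22})&0&r x_{13}\\ 0&p(x_{11}+x_{22})&t x_{32}\\ r x_{31}&t x_{23}&q x_{33}\end{pmatrix}\qquad(p,q>0,\ r,t\ge0). \] A linear map $\Phi$ is positive if it preserves positive semidefiniteness, $k$-positive if $\operatorname{id}_{M_k}\otimes\Phi$ is positive, completely positive if $k$-positive for all $k$. With $\mathsf T$ the transposition, $\Phi$ is $k$-copositive (resp. completely copositive) if $\mathsf T\circ\Phi$ is $k$-positive (resp. completely positive). $\Phi$ is decomposable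 if it is a sum of a completely positive and a completely copositive map. A positive map is atomic if it cannot be written as a sum of a $2$-positive and a $2$-copositive map. *)

theory Defs
  imports "Jordan_Normal_Form.Schur_Decomposition"
begin

text \<open>
  The algebra of complex \<open>n \<times> n\<close> matrices is \<open>carrier_mat n n\<close>; a map on it is a function on
  \<open>complex mat\<close> of which only the values on this carrier matter. Matrix indices start at \<open>0\<close>.
\<close>

text \<open>
  The order on \<open>complex\<close> is the one of \<open>Complex_Order\<close>: \<open>0 \<le> z\<close> says that \<open>z\<close> is real and
  nonnegative.
\<close>

definition psd :: "nat \<Rightarrow> complex mat \<Rightarrow> bool" where
  "psd n A \<longleftrightarrow> A \<in> carrier_mat n n \<and> mat_adjoint A = A \<and>
     (\<forall>v \<in> carrier_vec n. 0 \<le> (A *\<^sub>v v) \<bullet>c v)"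

definition mat_linear :: "nat \<Rightarrow> (complex mat \<Rightarrow> complex mat) \<Rightarrow> bool" where
  "mat_linear n \<Phi> \<longleftrightarrow>
     (\<forall>X \<in> carrier_mat n n. \<Phi> X \<in> carrier_mat n n) \<and>
     (\<forall>X \<in> carrier_mat n n. \<forall>Y \<in> carrier_mat n n. \<Phi> (X + Y) = \<Phi> X + \<Phi> Y) \<and>
     (\<forall>c. \<forall>X \<in> carrier_mat n n. \<Phi> (c \<cdot>\<^sub>m X) = c \<cdot>\<^sub>m \<Phi> X)"

definition positive_map :: "nat \<Rightarrow> (complex mat \<Rightarrow> complex mat) \<Rightarrow> bool" where
  "positive_map n \<Phi> \<longleftrightarrow> mat_linear n \<Phi> \<and> (\<forall>X. psd n X \<longrightarrow> psd n (\<Phi> X))"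

text \<open>
  The tensor product of the \<open>k \<times> k\<close> and the \<open>n \<times> n\<close> matrices is identified with the
  \<open>kn \<times> kn\<close> matrices by the Kronecker product: such a matrix is a \<open>k \<times> k\<close> array of blocks of
  size \<open>n\<close>, and the identity tensored with \<open>\<Phi>\<close> applies \<open>\<Phi>\<close> to every block.
\<close>

definition block :: "nat \<Rightarrow> complex mat \<Rightarrow> nat \<Rightarrow> nat \<Rightarrow> complex mat" where
  "block n X i j = mat n n (\<lambda>(a, b). X $$ (i * n + a, j * n + b))"

definition id_tensor :: "nat \<Rightarrow> nat \<Rightarrow> (complex mat \<Rightarrow> complex mat) \<Rightarrow> complex mat \<Rightarrow> complex mat" where
  "id_tensor k n \<Phi> X = mat (k * n) (k * n)
     (\<lambda>(i, j). \<Phi> (block n X (i div n) (j div n)) $$ (i mod n, j mod n))"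

definition k_positive :: "nat \<Rightarrow> nat \<Rightarrow> (complex mat \<Rightarrow> complex mat) \<Rightarrow> bool" where
  "k_positive k n \<Phi> \<longleftrightarrow> mat_linear n \<Phi> \<and> positive_map (k * n) (id_tensor k n \<Phi>)"

definition completely_positive :: "nat \<Rightarrow> (complex mat \<Rightarrow> complex mat) \<Rightarrow> bool" where
  "completely_positive n \<Phi> \<longleftrightarrow> (\<forall>k \<ge> 1. k_positive k n \<Phi>)"

definition k_copositive :: "nat \<Rightarrow> nat \<Rightarrow> (complex mat \<Rightarrow> complex mat) \<Rightarrow> bool" where
  "k_copositive k n \<Phi> \<longleftrightarrow> k_positive k n (transpose_mat \<circ> \<Phi>)"

definition completely_copositive :: "nat \<Rightarrow> (complex mat \<Rightarrow> complex mat) \<Rightarrow> bool" where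
  "completely_copositive n \<Phi> \<longleftrightarrow> completely_positive n (transpose_mat \<circ> \<Phi>)"

definition decomposable :: "nat \<Rightarrow> (complex mat \<Rightarrow> complex mat) \<Rightarrow> bool" where
  "decomposable n \<Phi> \<longleftrightarrow> (\<exists>\<Phi>\<^sub>1 \<Phi>\<^sub>2. completely_positive n \<Phi>\<^sub>1 \<and> completely_copositive n \<Phi>\<^sub>2 \<and>
     (\<forall>X \<in> carrier_mat n n. \<Phi> X = \<Phi>\<^sub>1 X + \<Phi>\<^sub>2 X))"

definition atomic :: "nat \<Rightarrow> (complex mat \<Rightarrow> complex mat) \<Rightarrow> bool" where
  "atomic n \<Phi> \<longleftrightarrow> positive_map n \<Phi> \<and>
     \<not> (\<exists>\<Phi>\<^sub>1 \<Phi>\<^sub>2. k_positive 2 n \<Phi>\<^sub>1 \<and> k_copositive 2 n \<Phi>\<^sub>2 \<and>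
          (\<forall>X \<in> carrier_mat n n. \<Phi> X = \<Phi>\<^sub>1 X + \<Phi>\<^sub>2 X))"

definition Psi :: "real \<Rightarrow> real \<Rightarrow> real \<Rightarrow> real \<Rightarrow> complex mat \<Rightarrow> complex mat" where
  "Psi p q r t X = mat_of_rows_list 3
     [[of_real p * (X $$ (0,0) + X $$ (1,1)), 0, of_real r * X $$ (0,2)],
      [0, of_real p * (X $$ (0,0) + X $$ (1,1)), of_real t * X $$ (2,1)],
      [of_real r * X $$ (2,0), of_real t * X $$ (1,2), of_real q * X $$ (2,2)]]"

end

theory Submission
  imports Defs
begin

text \<open>
  Everything turns on how the two off-diagonal entries \<open>R x\<^sub>1\<^sub>3\<close> and \<open>T x\<^sub>3\<^sub>2\<close> are paid for by the
  diagonal. (Indices in these formulas start at 1, those in the formal text at 0.)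

  For positivity alone the diagonal may be used twice. Testing against a vector \<open>(u, v, z)\<close>, the
  scalar \<open>|u|\<^sup>2 + |v|\<^sup>2\<close> times the quadratic form of the image is a sum of two values of the quadratic
  form of \<open>X\<close> and of \<open>|z|\<^sup>2 ((1 - R\<^sup>2) |u|\<^sup>2 + (1 - T\<^sup>2) |v|\<^sup>2) x\<^sub>3\<^sub>3\<close> (\<open>positive_Psi\<close>), so the two
  parameters are constrained separately; rank-one matrices show that the bounds \<open>1\<close> are sharp.

  A decomposition has to share \<open>x\<^sub>3\<^sub>3\<close> between the two summands. The entry \<open>R x\<^sub>1\<^sub>3\<close> can only come from
  the completely positive part, at the price of \<open>R\<^sup>2 x\<^sub>3\<^sub>3\<close>, and \<open>T x\<^sub>3\<^sub>2\<close>, which is transposed, only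
  from the completely copositive part, at the price of \<open>T\<^sup>2 x\<^sub>3\<^sub>3\<close>. If \<open>R\<^sup>2 + T\<^sup>2 \<le> 1\<close> explicit Kraus
  operators realise this (\<open>Psi_decomposition\<close>); for \<open>T = 0\<close> or \<open>R = 0\<close> the other summand is diagonal
  and hence fixed by transposition, which gives the two edges.

  Conversely, a 2-positive map \<open>\<Phi>\<close> satisfies
  \<open>|\<Phi>(E\<^sub>i\<^sub>j)\<^sub>a\<^sub>b|\<^sup>2 \<le> \<Phi>(E\<^sub>i\<^sub>i)\<^sub>a\<^sub>a \<Phi>(E\<^sub>j\<^sub>j)\<^sub>b\<^sub>b\<close> (\<open>two_positive_minor\<close>), and a 2-copositive one the same with
  \<open>a, b\<close> exchanged on the left. Applied to the two summands of a decomposition, these inequalities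
  yield \<open>R\<^sup>2 \<le> \<alpha>\<close> and \<open>T\<^sup>2 \<le> \<beta>\<close>, where \<open>\<alpha> + \<beta> = 1\<close> are the shares of the entry \<open>\<Psi>(E\<^sub>3\<^sub>3)\<^sub>3\<^sub>3 = 1\<close>.
  As only 2-positivity and 2-copositivity enter, this proves atomicity and the bound for decomposable
  maps at once (\<open>two_positive_two_copositive_sum_bound\<close>).
\<close>

section \<open>Quadratic forms of positive semidefinite matrices\<close>

text \<open>
  Vectors enter as functions, of which only the first \<open>n\<close> values count; the form then is a plain
  double sum, free of carrier conditions.
\<close>

definition qform :: "nat \<Rightarrow> complex mat \<Rightarrow> (nat \<Rightarrow> complex) \<Rightarrow> complex" where
  "qform n A v = (\<Sum>i<n. \<Sum>j<n. A $$ (i, j) * v j * cnj (v i))"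

lemma mat_adjoint_carrier: "A \<in> carrier_mat n m \<Longrightarrow> mat_adjoint A \<in> carrier_mat m n"
  unfolding mat_adjoint_def by auto

lemma mat_adjoint_index:
  assumes "A \<in> carrier_mat n m" "i < m" "j < n"
  shows "mat_adjoint A $$ (i, j) = cnj (A $$ (j, i))"
  using assms unfolding mat_adjoint_def by (auto simp: mat_of_rows_index)

lemma qform_eq_inner_prod:
  assumes "A \<in> carrier_mat n n"
  shows "(A *\<^sub>v vec n v) \<bullet>c vec n v = qform n A v"
  using assms unfolding qform_def
  by (auto simp: scalar_prod_def sum_distrib_right atLeast0LessThan intro!: sum.cong)

lemma qform_single:
  assumes "i < n"
  shows "qform n A (\<lambda>m. if m = i then x else 0) = A $$ (i, i) * x * cnj x"
proof -
  have *: "(\<Sum>m<n. f m * (if m = i then x else 0)) = f i * x" for f :: "nat \<Rightarrow> complex" and x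
    using assms by (simp add: if_distrib[of "(*) _"] cong: if_cong)
  have "qform n A (\<lambda>m. if m = i then x else 0) = (\<Sum>k<n. A $$ (k, i) * x * (if k = i then cnj x else 0))"
    unfolding qform_def
    by (simp only: sum_distrib_right[symmetric] * if_distrib[of cnj] complex_cnj_zero)
  also have "\<dots> = A $$ (i, i) * x * cnj x" by (rule *)
  finally show ?thesis .
qed

lemma qform_pair:
  assumes "i < n" "j < n" "i \<noteq> j"
  shows "qform n A (\<lambda>m. if m = i then x else if m = j then y else 0) =
    A $$ (i, i) * x * cnj x + A $$ (i, j) * y * cnj x + A $$ (j, i) * x * cnj y + A $$ (j, j) * y * cnj y"
proof -
  have *: "(\<Sum>m<n. f m * (if m = i then x else if m = j then y else 0)) = f i * x + f j * y"
    for f :: "nat \<Rightarrow> complex" and x y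
  proof -
    have "(\<Sum>m<n. f m * (if m = i then x else if m = j then y else 0)) =
      (\<Sum>m<n. (if m = i then f i * x else 0) + (if m = j then f j * y else 0))"
      using assms by (intro sum.cong) auto
    then show ?thesis using assms by (simp add: sum.distrib)
  qed
  have "qform n A (\<lambda>m. if m = i then x else if m = j then y else 0) =
    (\<Sum>k<n. (A $$ (k, i) * x + A $$ (k, j) * y) * (if k = i then cnj x else if k = j then cnj y else 0))"
    unfolding qform_def
    by (simp only: sum_distrib_right[symmetric] * if_distrib[of cnj] complex_cnj_zero)
  also have "\<dots> = (A $$ (i, i) * x + A $$ (i, j) * y) * cnj x + (A $$ (j, i) * x + A $$ (j, j) * y) * cnj y"
    by (rule *)
  finally show ?thesis by (simp add: algebra_simps)
qed

text \<open>
  Over the complex numbers a form with real values comes from a Hermitian matrix, by polarisation.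
  Hence self-adjointness never has to be checked separately below.
\<close>

lemma psd_iff_qform:
  "psd n A \<longleftrightarrow> A \<in> carrier_mat n n \<and> (\<forall>v. 0 \<le> qform n A v)"
proof
  assume "psd n A"
  then have A: "A \<in> carrier_mat n n" and pos: "\<And>v. v \<in> carrier_vec n \<Longrightarrow> 0 \<le> (A *\<^sub>v v) \<bullet>c v"
    unfolding psd_def by auto
  have "0 \<le> qform n A v" for v
    using pos[of "vec n v"] qform_eq_inner_prod[OF A] by simp
  with A show "A \<in> carrier_mat n n \<and> (\<forall>v. 0 \<le> qform n A v)" by blast
next
  assume *: "A \<in> carrier_mat n n \<and> (\<forall>v. 0 \<le> qform n A v)"
  then have A: "A \<in> carrier_mat n n" and pos: "\<And>v. 0 \<le> qform n A v" by auto
  have "cnj (A $$ (j, i)) = A $$ (i, j)" if ij: "i < n" "j < n" for i j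
  proof (cases "i = j")
    case True
    then show ?thesis using pos[of "\<lambda>m. if m = i then 1 else 0"] ij
      by (auto simp: qform_single less_eq_complex_def complex_eq_iff)
  next
    case False
    have d: "Im (A $$ (k, k)) = 0" if "k < n" for k
      using pos[of "\<lambda>m. if m = k then 1 else 0"] that
      by (auto simp: qform_single less_eq_complex_def)
    \<comment> \<open>the vectors \<open>e\<^sub>i + e\<^sub>j\<close> and \<open>e\<^sub>i + \<i> e\<^sub>j\<close> give the imaginary and the real part of the entry\<close>
    show ?thesis
      using pos[of "\<lambda>m. if m = i then 1 else if m = j then 1 else 0"]
        pos[of "\<lambda>m. if m = i then 1 else if m = j then \<i> else 0"] d[of i] d[of j] ij False
      by (auto simp: qform_pair less_eq_complex_def complex_eq_iff)
  qed
  then have "mat_adjoint A = A"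
    using A mat_adjoint_carrier[OF A] by (intro eq_matI) (auto simp: mat_adjoint_index[OF A])
  moreover have "0 \<le> (A *\<^sub>v v) \<bullet>c v" if "v \<in> carrier_vec n" for v
  proof -
    have "v = vec n (\<lambda>i. v $ i)" using that by auto
    then show ?thesis using qform_eq_inner_prod[OF A, of "\<lambda>i. v $ i"] pos by metis
  qed
  ultimately show "psd n A" unfolding psd_def using A by blast
qed

lemma psd_diag_nonneg:
  assumes "psd n A" "i < n"
  shows "0 \<le> A $$ (i, i)"
proof -
  have "0 \<le> qform n A (\<lambda>m. if m = i then 1 else 0)" using assms psd_iff_qform by blast
  then show ?thesis using assms by (simp add: qform_single)
qed

text \<open>
  This is nonnegativity of the principal minor, obtained by evaluating the form on the vectors
  \<open>s A\<^sub>i\<^sub>j e\<^sub>i - t e\<^sub>j\<close> with real \<open>s, t\<close>.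
\<close>

lemma psd_minor:
  assumes A: "psd n A" and ij: "i < n" "j < n"
  shows "(cmod (A $$ (i, j)))\<^sup>2 \<le> Re (A $$ (i, i)) * Re (A $$ (j, j))"
proof (cases "i = j")
  case True
  have "A $$ (i, i) = of_real (Re (A $$ (i, i)))"
    using psd_diag_nonneg[OF A ij(1)] by (auto simp: less_eq_complex_def complex_eq_iff)
  then show ?thesis using True by (metis norm_of_real order_refl power2_abs power2_eq_square)
next
  case False
  define c where "c = A $$ (i, j)"
  obtain a b where ab: "A $$ (i, i) = of_real a" "A $$ (j, j) = of_real b" "0 \<le> a" "0 \<le> b"
  proof
    show "A $$ (i, i) = of_real (Re (A $$ (i, i)))" "A $$ (j, j) = of_real (Re (A $$ (j, j)))"
      "0 \<le> Re (A $$ (i, i))" "0 \<le> Re (A $$ (j, j))"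
      using psd_diag_nonneg[OF A] ij by (auto simp: less_eq_complex_def complex_eq_iff)
  qed
  have car: "A \<in> carrier_mat n n" and h: "mat_adjoint A = A" using A unfolding psd_def by auto
  have ji: "A $$ (j, i) = cnj c" using mat_adjoint_index[OF car ij(2,1)] h c_def by simp
  have q: "0 \<le> a * s\<^sup>2 * (cmod c)\<^sup>2 - 2 * s * t * (cmod c)\<^sup>2 + b * t\<^sup>2" for s t :: real
  proof -
    have "0 \<le> qform n A (\<lambda>m. if m = i then of_real s * c else if m = j then - of_real t else 0)"
      using A psd_iff_qform by blast
    also have "\<dots> = of_real a * (of_real s * c) * cnj (of_real s * c)
       + c * (- of_real t) * cnj (of_real s * c)
       + cnj c * (of_real s * c) * cnj (- of_real t)
       + of_real b * (- of_real t) * cnj (- of_real t)"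
      unfolding qform_pair[OF ij False] ji ab c_def[symmetric] ..
    also have "\<dots> = of_real (a * s\<^sup>2 * (cmod c)\<^sup>2 - 2 * s * t * (cmod c)\<^sup>2 + b * t\<^sup>2)"
      by (simp add: complex_norm_square algebra_simps del: of_real_power)
        (simp add: power2_eq_square algebra_simps)
    finally show ?thesis by (simp only: less_eq_complex_def) simp
  qed
  have "(cmod c)\<^sup>2 \<le> a * b"
  proof (cases "a = 0")
    case True
    have "c = 0"
    proof (rule ccontr)
      assume "c \<noteq> 0"
      then have c: "(cmod c)\<^sup>2 > 0" by simp
      \<comment> \<open>with \<open>a = 0\<close> the form is affine in \<open>s\<close>, and at this \<open>s\<close> it is already negative\<close>
      have "0 \<le> - 2 * (b / (cmod c)\<^sup>2) * (cmod c)\<^sup>2 - 2 * (cmod c)\<^sup>2 + b"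
        using q[of "b / (cmod c)\<^sup>2 + 1" 1] True by (simp add: algebra_simps)
      also have "\<dots> = - b - 2 * (cmod c)\<^sup>2" using \<open>c \<noteq> 0\<close> by simp
      finally show False using c ab by linarith
    qed
    then show ?thesis using ab by simp
  next
    case False
    have "0 \<le> a * (a * b - (cmod c)\<^sup>2)" using q[of 1 a] by (simp add: algebra_simps power2_eq_square)
    then show ?thesis using False ab by (simp add: zero_le_mult_iff)
  qed
  then show ?thesis by (simp add: ab c_def)
qed

lemma psd_rank_one:
  "psd n (mat n n (\<lambda>(i, j). f i * cnj (f j)))"
proof -
  have q: "qform n (mat n n (\<lambda>(i, j). f i * cnj (f j))) v
    = (\<Sum>j<n. cnj (f j) * v j) * cnj (\<Sum>i<n. cnj (f i) * v i)" for v
    unfolding qform_def by (simp add: sum_product mult_ac)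
  have "0 \<le> z * cnj z" for z :: complex
    by (simp add: complex_mult_cnj less_eq_complex_def)
  then show ?thesis unfolding psd_iff_qform by (simp only: q mat_carrier simp_thms)
qed

lemma psd_add:
  assumes "psd n A" "psd n B"
  shows "psd n (A + B)"
proof -
  have c: "A \<in> carrier_mat n n" "B \<in> carrier_mat n n" using assms unfolding psd_def by blast+
  then have "qform n (A + B) v = qform n A v + qform n B v" for v
    unfolding qform_def sum.distrib[symmetric]
    by (intro sum.cong refl) (simp add: ring_distribs)
  moreover have "0 \<le> qform n A v" "0 \<le> qform n B v" for v
    using assms psd_iff_qform by blast+
  ultimately show ?thesis using c unfolding psd_iff_qform by (metis add_carrier_mat add_nonneg_nonneg)
qed

section \<open>Kraus maps are completely positive\<close>

text \<open>
  The map \<open>X \<mapsto> V X V\<^sup>*\<close>, written with entries so that its ampliations are maps of the same kind.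
\<close>

definition kraus :: "nat \<Rightarrow> (nat \<Rightarrow> nat \<Rightarrow> complex) \<Rightarrow> complex mat \<Rightarrow> complex mat" where
  "kraus n V X = mat n n (\<lambda>(a, b). \<Sum>c<n. \<Sum>d<n. V a c * X $$ (c, d) * cnj (V b d))"

text \<open>
  The form of \<open>V X V\<^sup>*\<close> at \<open>v\<close> is the form of \<open>X\<close> at \<open>V\<^sup>* v\<close>.
\<close>

lemma psd_kraus:
  assumes "psd n X"
  shows "psd n (kraus n V X)"
proof -
  have "qform n (kraus n V X) v = qform n X (\<lambda>d. \<Sum>b<n. cnj (V b d) * v b)" for v
  proof -
    let ?t = "\<lambda>a b c d. V a c * X $$ (c, d) * cnj (V b d) * v b * cnj (v a)"
    have "qform n (kraus n V X) v = (\<Sum>a<n. \<Sum>b<n. \<Sum>c<n. \<Sum>d<n. ?t a b c d)"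
      unfolding qform_def kraus_def by (simp add: sum_distrib_right)
    also have "\<dots> = (\<Sum>a<n. \<Sum>c<n. \<Sum>d<n. \<Sum>b<n. ?t a b c d)"
      by (rule sum.cong[OF refl], subst sum.swap, rule sum.cong[OF refl], rule sum.swap)
    also have "\<dots> = (\<Sum>c<n. \<Sum>d<n. \<Sum>a<n. \<Sum>b<n. ?t a b c d)"
      by (subst sum.swap, rule sum.cong[OF refl], rule sum.swap)
    also have "\<dots> = (\<Sum>c<n. \<Sum>d<n. \<Sum>b<n. \<Sum>a<n. ?t a b c d)"
      by (intro sum.cong[OF refl] sum.swap)
    also have "\<dots> = qform n X (\<lambda>d. \<Sum>b<n. cnj (V b d) * v b)"
      unfolding qform_def
      by (simp add: sum_product sum_distrib_left mult_ac)
    finally show ?thesis .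
  qed
  then show ?thesis using assms unfolding psd_iff_qform by (simp add: kraus_def)
qed

lemma block_carrier: "block n X i j \<in> carrier_mat n n"
  unfolding block_def by simp

lemma block_index_less:
  fixes i j k n :: nat
  assumes "i < k * n"
  shows "i div n < k" "i mod n < n"
proof -
  show "i div n < k" using assms by (simp add: less_mult_imp_div_less)
  show "i mod n < n" using assms by (cases "n = 0") auto
qed

lemma block_pos_less:
  fixes p a k n :: nat
  assumes "p < k" "a < n"
  shows "p * n + a < k * n"
proof -
  have "p * n + a < (p + 1) * n" using assms by simp
  also have "\<dots> \<le> k * n" using assms by (intro mult_right_mono) auto
  finally show ?thesis .
qed

text \<open>
  Linearity is part of positivity of a map; it passes to ampliations, so that \<open>k\<close>-positivity
  only needs to be tested on matrices.
\<close>

lemma mat_linear_id_tensor: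
  assumes "mat_linear n \<Phi>"
  shows "mat_linear (k * n) (id_tensor k n \<Phi>)"
proof -
  have c: "\<And>X. X \<in> carrier_mat n n \<Longrightarrow> \<Phi> X \<in> carrier_mat n n"
    and a: "\<And>X Y. X \<in> carrier_mat n n \<Longrightarrow> Y \<in> carrier_mat n n \<Longrightarrow> \<Phi> (X + Y) = \<Phi> X + \<Phi> Y"
    and s: "\<And>c X. X \<in> carrier_mat n n \<Longrightarrow> \<Phi> (c \<cdot>\<^sub>m X) = c \<cdot>\<^sub>m \<Phi> X"
    using assms unfolding mat_linear_def by auto
  note [simp] = block_index_less block_carrier block_pos_less
  have ba: "block n ((X :: complex mat) + Y) i j = block n X i j + block n Y i j"
    if "X \<in> carrier_mat (k * n) (k * n)" "Y \<in> carrier_mat (k * n) (k * n)" "i < k" "j < k" for X Y i j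
    using that unfolding block_def by (intro eq_matI) auto
  have bs: "block n (z \<cdot>\<^sub>m X) i j = z \<cdot>\<^sub>m block n X i j"
    if "X \<in> carrier_mat (k * n) (k * n)" "i < k" "j < k" for z X i j
    using that unfolding block_def by (intro eq_matI) auto
  have d: "dim_row (\<Phi> (block n X i j)) = n" "dim_col (\<Phi> (block n X i j)) = n" for X i j
    using c[of "block n X i j"] by auto
  show ?thesis unfolding mat_linear_def
  proof (intro conjI ballI allI)
    fix X Y :: "complex mat"
    assume XY: "X \<in> carrier_mat (k * n) (k * n)" "Y \<in> carrier_mat (k * n) (k * n)"
    show "id_tensor k n \<Phi> (X + Y) = id_tensor k n \<Phi> X + id_tensor k n \<Phi> Y"
      using XY by (intro eq_matI) (auto simp: id_tensor_def ba a d)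
  next
    fix z and X :: "complex mat" assume X: "X \<in> carrier_mat (k * n) (k * n)"
    show "id_tensor k n \<Phi> (z \<cdot>\<^sub>m X) = z \<cdot>\<^sub>m id_tensor k n \<Phi> X"
      using X by (intro eq_matI) (auto simp: id_tensor_def bs s d)
  qed (simp add: id_tensor_def)
qed

lemma k_positiveI:
  assumes "mat_linear n \<Phi>" "\<And>X. psd (k * n) X \<Longrightarrow> psd (k * n) (id_tensor k n \<Phi> X)"
  shows "k_positive k n \<Phi>"
  using assms mat_linear_id_tensor unfolding k_positive_def positive_map_def by blast

lemma mat_linear_kraus: "mat_linear n (kraus n V)"
  unfolding mat_linear_def
proof (intro conjI ballI allI)
  fix X Y :: "complex mat"
  assume "X \<in> carrier_mat n n" "Y \<in> carrier_mat n n"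
  then have "V a c * (X + Y) $$ (c, d) * cnj (V b d) =
      V a c * X $$ (c, d) * cnj (V b d) + V a c * Y $$ (c, d) * cnj (V b d)" if "c < n" "d < n" for a b c d
    using that by (simp add: ring_distribs)
  then show "kraus n V (X + Y) = kraus n V X + kraus n V Y"
    by (intro eq_matI) (simp_all add: kraus_def sum.distrib)
next
  fix z and X :: "complex mat"
  assume "X \<in> carrier_mat n n"
  then show "kraus n V (z \<cdot>\<^sub>m X) = z \<cdot>\<^sub>m kraus n V X"
    by (intro eq_matI) (auto simp: kraus_def sum_distrib_left mult_ac intro!: sum.cong)
qed (simp add: kraus_def)

lemma sum_over_block:
  fixes f :: "nat \<Rightarrow> complex"
  assumes "p < k"
  shows "(\<Sum>j<k * n. if p = j div n then f j else 0) = (\<Sum>c<n. f (p * n + c))"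
proof -
  have "(\<Sum>j<k * n. if p = j div n then f j else 0) = (\<Sum>j | j < k * n \<and> p = j div n. f j)"
    by (simp add: sum.inter_filter[symmetric])
  also have "\<dots> = (\<Sum>c<n. f (p * n + c))"
    by (rule sum.reindex_bij_witness[where i = "\<lambda>c. p * n + c" and j = "\<lambda>j. j mod n"])
      (auto simp: block_pos_less assms block_index_less)
  finally show ?thesis .
qed

text \<open>
  Tensoring \<open>X \<mapsto> V X V\<^sup>*\<close> with the identity gives conjugation by the block diagonal operator with
  \<open>k\<close> copies of \<open>V\<close>.
\<close>

lemma id_tensor_kraus:
  "id_tensor k n (kraus n V) X =
    kraus (k * n) (\<lambda>i j. if i div n = j div n then V (i mod n) (j mod n) else 0) X"
  (is "_ = kraus _ ?U X")
proof (rule eq_matI)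
  fix i j assume "i < dim_row (kraus (k * n) ?U X)" "j < dim_col (kraus (k * n) ?U X)"
  then have ij: "i < k * n" "j < k * n" by (auto simp: kraus_def)
  note l = block_index_less[OF ij(1)] block_index_less[OF ij(2)]
  have "kraus (k * n) ?U X $$ (i, j) = (\<Sum>c<k * n. if i div n = c div n then
      (\<Sum>d<k * n. if j div n = d div n then V (i mod n) (c mod n) * X $$ (c, d) * cnj (V (j mod n) (d mod n)) else 0)
      else 0)"
    using ij by (auto simp: kraus_def intro!: sum.cong)
  also have "\<dots> = id_tensor k n (kraus n V) X $$ (i, j)"
    using ij l by (simp add: sum_over_block id_tensor_def kraus_def block_def)
  finally show "id_tensor k n (kraus n V) X $$ (i, j) = kraus (k * n) ?U X $$ (i, j)" by simp
qed (auto simp: id_tensor_def kraus_def)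

lemma completely_positive_kraus: "completely_positive n (kraus n V)"
  unfolding completely_positive_def
  by (auto intro!: k_positiveI mat_linear_kraus simp: id_tensor_kraus psd_kraus)

lemma mat_linear_add:
  assumes "mat_linear n \<Phi>" "mat_linear n \<Psi>"
  shows "mat_linear n (\<lambda>X. \<Phi> X + \<Psi> X)"
  unfolding mat_linear_def
proof (intro conjI ballI allI)
  fix X Y :: "complex mat" and z :: complex
  assume X: "X \<in> carrier_mat n n"
  have c: "\<Phi> X \<in> carrier_mat n n" "\<Psi> X \<in> carrier_mat n n"
    using assms X unfolding mat_linear_def by auto
  then show "\<Phi> X + \<Psi> X \<in> carrier_mat n n" by simp
  show "\<Phi> (z \<cdot>\<^sub>m X) + \<Psi> (z \<cdot>\<^sub>m X) = z \<cdot>\<^sub>m (\<Phi> X + \<Psi> X)"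
    using assms X c add_smult_distrib_left_mat[OF c, of z] unfolding mat_linear_def by simp
  assume Y: "Y \<in> carrier_mat n n"
  have d: "\<Phi> Y \<in> carrier_mat n n" "\<Psi> Y \<in> carrier_mat n n"
    using assms Y unfolding mat_linear_def by auto
  have e: "\<Phi> (X + Y) = \<Phi> X + \<Phi> Y" "\<Psi> (X + Y) = \<Psi> X + \<Psi> Y"
    using assms X Y unfolding mat_linear_def by auto
  show "\<Phi> (X + Y) + \<Psi> (X + Y) = \<Phi> X + \<Psi> X + (\<Phi> Y + \<Psi> Y)"
    unfolding e using carrier_matD[OF c(1)] carrier_matD[OF c(2)] carrier_matD[OF d(1)] carrier_matD[OF d(2)]
    by (intro eq_matI) simp_all
qed

lemma completely_positive_add:
  assumes "completely_positive n \<Phi>" "completely_positive n \<Psi>"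
  shows "completely_positive n (\<lambda>X. \<Phi> X + \<Psi> X)"
  unfolding completely_positive_def
proof (intro allI impI k_positiveI)
  have l: "mat_linear n \<Phi>" "mat_linear n \<Psi>"
    using assms unfolding completely_positive_def k_positive_def by auto
  then show "mat_linear n (\<lambda>X. \<Phi> X + \<Psi> X)" by (rule mat_linear_add)
  have d: "\<Phi> (block n X i j) \<in> carrier_mat n n" "\<Psi> (block n X i j) \<in> carrier_mat n n" for X i j
    using l block_carrier[of n X i j] unfolding mat_linear_def by auto
  fix k :: nat and X assume "1 \<le> k" "psd (k * n) X"
  then have "psd (k * n) (id_tensor k n \<Phi> X + id_tensor k n \<Psi> X)"
    using assms by (auto simp: completely_positive_def k_positive_def positive_map_def intro: psd_add)
  also have "id_tensor k n \<Phi> X + id_tensor k n \<Psi> X = id_tensor k n (\<lambda>X. \<Phi> X + \<Psi> X) X"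
    using carrier_matD[OF d(1)] carrier_matD[OF d(2)]
    by (intro eq_matI) (auto simp: id_tensor_def block_index_less)
  finally show "psd (k * n) (id_tensor k n (\<lambda>X. \<Phi> X + \<Psi> X) X)" .
qed

lemma completely_positive_cong:
  assumes "completely_positive n \<Phi>" and eq: "\<And>X. X \<in> carrier_mat n n \<Longrightarrow> \<Phi> X = \<Psi> X"
  shows "completely_positive n \<Psi>"
  unfolding completely_positive_def
proof (intro allI impI k_positiveI)
  have l: "mat_linear n \<Phi>"
    using assms unfolding completely_positive_def k_positive_def by auto
  then show "mat_linear n \<Psi>" unfolding mat_linear_def
    by (simp add: eq[symmetric])
  fix k :: nat and X assume "1 \<le> k" "psd (k * n) X"
  then have "psd (k * n) (id_tensor k n \<Phi> X)"
    using assms by (auto simp: completely_positive_def k_positive_def positive_map_def)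
  also have "id_tensor k n \<Phi> X = id_tensor k n \<Psi> X"
    unfolding id_tensor_def by (simp add: eq block_carrier)
  finally show "psd (k * n) (id_tensor k n \<Psi> X)" .
qed

section \<open>Inequalities for 2-positive maps\<close>

definition mat_unit :: "nat \<Rightarrow> nat \<Rightarrow> nat \<Rightarrow> complex mat" where
  "mat_unit n i j = mat n n (\<lambda>(a, b). if a = i \<and> b = j then 1 else 0)"

text \<open>
  Feed the ampliation of \<open>\<Phi>\<close> the rank-one matrix of the vector \<open>e\<^sub>1 \<otimes> e\<^sub>i + e\<^sub>2 \<otimes> e\<^sub>j\<close>. Its four blocks are
  the matrix units of the pairs from \<open>{i, j}\<close>, and the claim is a principal minor of the result.
\<close>

lemma two_positive_minor:
  assumes \<Phi>: "k_positive 2 n \<Phi>" and lt: "i < n" "j < n" "a < n" "b < n"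
  shows "(cmod (\<Phi> (mat_unit n i j) $$ (a, b)))\<^sup>2 \<le>
      Re (\<Phi> (mat_unit n i i) $$ (a, a)) * Re (\<Phi> (mat_unit n j j) $$ (b, b))"
    and "0 \<le> Re (\<Phi> (mat_unit n i i) $$ (a, a))"
proof -
  define f :: "nat \<Rightarrow> complex" where "f m = (if m = i \<or> m = n + j then 1 else 0)" for m
  have f: "f c = (if c = i then 1 else 0)" "f (n + c) = (if c = j then 1 else 0)" if "c < n" for c
    using that lt unfolding f_def by auto
  define X where "X = mat (2 * n) (2 * n) (\<lambda>(p, q). f p * cnj (f q))"
  have psd: "psd (2 * n) (id_tensor 2 n \<Phi> X)"
    using \<Phi> psd_rank_one unfolding k_positive_def positive_map_def X_def by blast
  have blocks: "block n X 0 0 = mat_unit n i i" "block n X 0 1 = mat_unit n i j"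
    "block n X 1 1 = mat_unit n j j"
    by (rule eq_matI; simp add: block_def X_def mat_unit_def f)+
  have dm: "a div n = 0" "a mod n = a" "(n + b) div n = 1" "(n + b) mod n = b"
    using lt by simp_all
  have ent: "id_tensor 2 n \<Phi> X $$ (a, a) = \<Phi> (mat_unit n i i) $$ (a, a)"
    "id_tensor 2 n \<Phi> X $$ (a, n + b) = \<Phi> (mat_unit n i j) $$ (a, b)"
    "id_tensor 2 n \<Phi> X $$ (n + b, n + b) = \<Phi> (mat_unit n j j) $$ (b, b)"
    using lt unfolding id_tensor_def by (simp_all only: index_mat(1) dm blocks split)
  show "(cmod (\<Phi> (mat_unit n i j) $$ (a, b)))\<^sup>2 \<le>
      Re (\<Phi> (mat_unit n i i) $$ (a, a)) * Re (\<Phi> (mat_unit n j j) $$ (b, b))"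
    using psd_minor[OF psd, of a "n + b"] lt ent by simp
  show "0 \<le> Re (\<Phi> (mat_unit n i i) $$ (a, a))"
    using psd_diag_nonneg[OF psd, of a] lt ent by (simp add: less_eq_complex_def)
qed

text \<open>
  Transposing the values exchanges \<open>a\<close> and \<open>b\<close> on the left, but not on the diagonal entries on the right.
\<close>

lemma two_copositive_minor:
  assumes "k_copositive 2 n \<Phi>" and lt: "i < n" "j < n" "a < n" "b < n"
  shows "(cmod (\<Phi> (mat_unit n i j) $$ (b, a)))\<^sup>2 \<le>
      Re (\<Phi> (mat_unit n i i) $$ (a, a)) * Re (\<Phi> (mat_unit n j j) $$ (b, b))"
    and "0 \<le> Re (\<Phi> (mat_unit n i i) $$ (a, a))"
proof -
  have k: "k_positive 2 n (transpose_mat \<circ> \<Phi>)" using assms unfolding k_copositive_def by simp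
  have "mat_unit n p q \<in> carrier_mat n n" for p q unfolding mat_unit_def by simp
  then have "(transpose_mat \<circ> \<Phi>) (mat_unit n p q) \<in> carrier_mat n n" for p q
    using k unfolding k_positive_def mat_linear_def by blast
  then have "\<Phi> (mat_unit n p q) \<in> carrier_mat n n" for p q
    by simp
  from carrier_matD[OF this]
  show "(cmod (\<Phi> (mat_unit n i j) $$ (b, a)))\<^sup>2 \<le>
      Re (\<Phi> (mat_unit n i i) $$ (a, a)) * Re (\<Phi> (mat_unit n j j) $$ (b, b))"
    and "0 \<le> Re (\<Phi> (mat_unit n i i) $$ (a, a))"
    using two_positive_minor[OF k lt] lt by simp_all
qed

section \<open>The maps and their positivity\<close>

lemma sum3: "(\<Sum>i<3::nat. f i) = f 0 + f 1 + f 2" for f :: "nat \<Rightarrow> 'a :: comm_monoid_add"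
  by (simp add: numeral_3_eq_3 numeral_2_eq_2 lessThan_Suc add_ac)

lemma Psi_carrier: "Psi p q r t X \<in> carrier_mat 3 3"
  unfolding Psi_def mat_of_rows_list_def by (simp add: eval_nat_numeral)

lemma Psi_index:
  "Psi p q r t X $$ (0, 0) = of_real p * (X $$ (0, 0) + X $$ (1, 1))"
  "Psi p q r t X $$ (0, 1) = 0"
  "Psi p q r t X $$ (0, 2) = of_real r * X $$ (0, 2)"
  "Psi p q r t X $$ (1, 0) = 0"
  "Psi p q r t X $$ (1, 1) = of_real p * (X $$ (0, 0) + X $$ (1, 1))"
  "Psi p q r t X $$ (1, 2) = of_real t * X $$ (2, 1)"
  "Psi p q r t X $$ (2, 0) = of_real r * X $$ (2, 0)"
  "Psi p q r t X $$ (2, 1) = of_real t * X $$ (1, 2)"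
  "Psi p q r t X $$ (2, 2) = of_real q * X $$ (2, 2)"
  unfolding Psi_def mat_of_rows_list_def by simp_all

lemma eq_mat_3:
  assumes "A \<in> carrier_mat 3 3" "B \<in> carrier_mat 3 3"
    and "A $$ (0, 0) = B $$ (0, 0)" "A $$ (0, 1) = B $$ (0, 1)" "A $$ (0, 2) = B $$ (0, 2)"
      "A $$ (1, 0) = B $$ (1, 0)" "A $$ (1, 1) = B $$ (1, 1)" "A $$ (1, 2) = B $$ (1, 2)"
      "A $$ (2, 0) = B $$ (2, 0)" "A $$ (2, 1) = B $$ (2, 1)" "A $$ (2, 2) = B $$ (2, 2)"
  shows "A = B"
proof (rule eq_matI)
  fix i j assume "i < dim_row B" "j < dim_col B"
  then have "i = 0 \<or> i = 1 \<or> i = 2" "j = 0 \<or> j = 1 \<or> j = 2" using assms(2) by auto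
  then show "A $$ (i, j) = B $$ (i, j)" using assms(3-) by metis
qed (use assms in auto)

lemma mat_linear_Psi: "mat_linear 3 (Psi p q r t)"
  unfolding mat_linear_def
proof (intro conjI ballI allI)
  fix X Y :: "complex mat"
  assume "X \<in> carrier_mat 3 3" "Y \<in> carrier_mat 3 3"
  then show "Psi p q r t (X + Y) = Psi p q r t X + Psi p q r t Y"
    using carrier_matD[OF Psi_carrier[of p q r t Y]]
    by (intro eq_mat_3 Psi_carrier add_carrier_mat) (simp_all add: Psi_index[simplified] algebra_simps)
next
  fix z and X :: "complex mat"
  assume "X \<in> carrier_mat 3 3"
  then show "Psi p q r t (z \<cdot>\<^sub>m X) = z \<cdot>\<^sub>m Psi p q r t X"
    using carrier_matD[OF Psi_carrier[of p q r t X]]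
    by (intro eq_mat_3 Psi_carrier smult_carrier_mat) (simp_all add: Psi_index[simplified] algebra_simps)
qed (rule Psi_carrier)

text \<open>
  For a vector with entries \<open>u, v, z\<close>, the form of the image is a pairing of \<open>X\<close> with a matrix whose
  upper left corner is \<open>s\<close> times the identity, \<open>s = |u|\<^sup>2 + |v|\<^sup>2\<close>. Eliminating with this corner as pivot
  leaves two rank-one terms, given by the vectors \<open>(s, 0, R z u\<^sup>*)\<close> and \<open>(0, s, T v z\<^sup>*)\<close>, and a
  Schur complement \<open>d\<close> in the last diagonal entry, which is nonnegative since \<open>R, T \<le> 1\<close>.
  Multiplication by \<open>s\<close> avoids denominators; for \<open>s = 0\<close> only \<open>|z|\<^sup>2 x\<^sub>3\<^sub>3\<close> remains.
\<close>

lemma positive_Psi: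
  assumes R: "0 \<le> R" "R \<le> 1" and T: "0 \<le> T" "T \<le> 1"
  shows "positive_map 3 (Psi 1 1 R T)"
  unfolding positive_map_def
proof (intro conjI allI impI mat_linear_Psi)
  fix X assume X: "psd 3 X"
  have q: "0 \<le> qform 3 X v" for v using X psd_iff_qform by blast
  have "0 \<le> qform 3 (Psi 1 1 R T X) w" for w
  proof -
    define u v z where uvz: "u = w 0" "v = w 1" "z = w 2"
    define s where "s = (cmod u)\<^sup>2 + (cmod v)\<^sup>2"
    define d where "d = (cmod z)\<^sup>2 * ((1 - R\<^sup>2) * (cmod u)\<^sup>2 + (1 - T\<^sup>2) * (cmod v)\<^sup>2)"
    let ?y1 = "\<lambda>i. if i = 0 then of_real s else if i = 2 then of_real R * z * cnj u else 0"
    let ?y2 = "\<lambda>i. if i = 1 then of_real s else if i = 2 then of_real T * v * cnj z else 0"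
    have d0: "0 \<le> d" unfolding d_def using R T by (simp add: power_le_one)
    have X33: "0 \<le> X $$ (2, 2)" using psd_diag_nonneg[OF X] by simp
    have sd: "of_real s = u * cnj u + v * cnj v"
      "of_real d = z * cnj z * ((1 - of_real R * of_real R) * (u * cnj u) + (1 - of_real T * of_real T) * (v * cnj v))"
      unfolding s_def d_def by (simp_all add: complex_norm_square[symmetric] power2_eq_square)
    have y1: "qform 3 X ?y1 = X $$ (0, 0) * of_real s * of_real s + X $$ (0, 2) * (of_real R * z * cnj u) * of_real s
        + X $$ (2, 0) * of_real s * (of_real R * cnj z * u) + X $$ (2, 2) * (of_real R * z * cnj u) * (of_real R * cnj z * u)"
      by (subst qform_pair) simp_all
    have y2: "qform 3 X ?y2 = X $$ (1, 1) * of_real s * of_real s + X $$ (1, 2) * (of_real T * v * cnj z) * of_real s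
        + X $$ (2, 1) * of_real s * (of_real T * cnj v * z) + X $$ (2, 2) * (of_real T * v * cnj z) * (of_real T * cnj v * z)"
      by (subst qform_pair) simp_all
    have w: "qform 3 (Psi 1 1 R T X) w = (X $$ (0, 0) + X $$ (1, 1)) * (u * cnj u + v * cnj v)
        + of_real R * X $$ (0, 2) * z * cnj u + of_real T * X $$ (2, 1) * z * cnj v
        + of_real R * X $$ (2, 0) * u * cnj z + of_real T * X $$ (1, 2) * v * cnj z + X $$ (2, 2) * z * cnj z"
      unfolding qform_def sum3 Psi_index uvz by (simp add: algebra_simps)
    have "of_real s * qform 3 (Psi 1 1 R T X) w = qform 3 X ?y1 + qform 3 X ?y2 + of_real d * X $$ (2, 2)"
      unfolding y1 y2 w unfolding sd by (simp add: algebra_simps)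
    moreover have "0 \<le> \<dots>"
      using q[of ?y1] q[of ?y2] X33 d0 by (simp add: less_eq_complex_def)
    ultimately have sq: "0 \<le> of_real s * qform 3 (Psi 1 1 R T X) w" by metis
    show "0 \<le> qform 3 (Psi 1 1 R T X) w"
    proof (cases "s = 0")
      case True
      then have "u = 0" "v = 0" unfolding s_def by (auto simp: add_nonneg_eq_0_iff)
      then have "qform 3 (Psi 1 1 R T X) w = X $$ (2, 2) * (z * cnj z)"
        unfolding w by simp
      then show ?thesis using X33 by (simp add: complex_mult_cnj less_eq_complex_def)
    next
      case False
      then have "s > 0" unfolding s_def by (simp add: sum_power2_gt_zero_iff less_le)
      then show ?thesis using sq by (simp add: less_eq_complex_def zero_le_mult_iff)
    qed
  qed
  then show "psd 3 (Psi 1 1 R T X)" unfolding psd_iff_qform by (simp add: Psi_carrier)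
qed

text \<open>
  Each of the images of the rank-one matrices of \<open>(1, 0, 1)\<close> and \<open>(0, 1, 1)\<close> has a principal minor with
  unit diagonal and off-diagonal entry \<open>R\<close>, respectively \<open>T\<close>.
\<close>

lemma positive_Psi_bounds:
  assumes "positive_map 3 (Psi 1 1 R T)"
  shows "\<bar>R\<bar> \<le> 1" "\<bar>T\<bar> \<le> 1"
proof -
  have P: "psd 3 (Psi 1 1 R T (mat 3 3 (\<lambda>(i, j). f i * cnj (f j))))" for f
    using assms psd_rank_one unfolding positive_map_def by blast
  show "\<bar>R\<bar> \<le> 1"
    using psd_minor[OF P[of "\<lambda>i. if i = 1 then 0 else 1"], of 0 2]
    by (simp add: Psi_index abs_square_le_1)
  show "\<bar>T\<bar> \<le> 1"
    using psd_minor[OF P[of "\<lambda>i. if i = 0 then 0 else 1"], of 1 2]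
    by (simp add: Psi_index Psi_index[unfolded One_nat_def] abs_square_le_1)
qed

section \<open>Explicit decompositions in the quarter disk\<close>

definition diag_op :: "complex list \<Rightarrow> nat \<Rightarrow> nat \<Rightarrow> complex" where
  "diag_op ds i j = (if i = j then ds ! i else 0)"

definition unit_op :: "nat \<Rightarrow> nat \<Rightarrow> nat \<Rightarrow> nat \<Rightarrow> complex" where
  "unit_op p q i j = (if i = p \<and> j = q then 1 else 0)"

text \<open>
  The operator \<open>diag(1, 0, R)\<close> produces the entries \<open>R x\<^sub>1\<^sub>3\<close> and \<open>R x\<^sub>3\<^sub>1\<close> together with \<open>x\<^sub>1\<^sub>1\<close> and
  \<open>R\<^sup>2 x\<^sub>3\<^sub>3\<close>. The two matrix units move \<open>x\<^sub>2\<^sub>2\<close> to the first and \<open>x\<^sub>1\<^sub>1\<close> to the second diagonal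
  position. Since the transposed summand will use \<open>T\<^sup>2 x\<^sub>3\<^sub>3\<close>, the last operator supplies what is left of
  \<open>x\<^sub>3\<^sub>3\<close>, and this is where \<open>R\<^sup>2 + T\<^sup>2 \<le> 1\<close> is needed.
\<close>

definition Psi_cp :: "real \<Rightarrow> real \<Rightarrow> complex mat \<Rightarrow> complex mat" where
  "Psi_cp R T X = kraus 3 (diag_op [1, 0, of_real R]) X + kraus 3 (unit_op 0 1) X
     + kraus 3 (unit_op 1 0) X + kraus 3 (diag_op [0, 0, of_real (sqrt (1 - R\<^sup>2 - T\<^sup>2))]) X"

lemma completely_positive_Psi_cp: "completely_positive 3 (Psi_cp R T)"
  unfolding Psi_cp_def[abs_def]
  by (intro completely_positive_add completely_positive_kraus)

lemma Psi_decomposition: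
  assumes "R\<^sup>2 + T\<^sup>2 \<le> 1"
  shows "Psi 1 1 R T X = Psi_cp R T X + transpose_mat (kraus 3 (diag_op [0, 1, of_real T]) X)"
proof -
  define \<kappa> where "\<kappa> = sqrt (1 - R\<^sup>2 - T\<^sup>2)"
  have "\<kappa> * \<kappa> = 1 - R * R - T * T"
    using assms unfolding \<kappa>_def by (simp add: power2_eq_square)
  then have c: "of_real \<kappa> * of_real \<kappa> = (1 - of_real R * of_real R - of_real T * of_real T :: complex)"
    unfolding of_real_mult[symmetric] by simp
  have c': "of_real \<kappa> * (of_real \<kappa> * x) = (1 - of_real R * of_real R - of_real T * of_real T) * x" for x :: complex
    unfolding c[symmetric] by (simp add: mult.assoc)
  have car: "kraus 3 V X \<in> carrier_mat 3 3" for V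
    unfolding kraus_def by simp
  have ind: "kraus 3 V X $$ (i, j) = (\<Sum>c<3. \<Sum>d<3. V i c * X $$ (c, d) * cnj (V j d))" if "i < 3" "j < 3" for V i j
    using that unfolding kraus_def by simp
  note [simp] = carrier_matD[OF car]
  show ?thesis unfolding Psi_cp_def \<kappa>_def[symmetric]
    by (rule eq_mat_3) (simp_all add: Psi_carrier car ind diag_op_def unit_op_def sum3
        Psi_index[simplified] c c' algebra_simps)
qed

lemma completely_copositive_transpose_kraus:
  "completely_copositive n (\<lambda>X. transpose_mat (kraus n V X))"
  using completely_positive_kraus[of n V] unfolding completely_copositive_def comp_def by simp

lemma decomposable_Psi:
  assumes "R\<^sup>2 + T\<^sup>2 \<le> 1"
  shows "decomposable 3 (Psi 1 1 R T)"
  unfolding decomposable_def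
  using completely_positive_Psi_cp completely_copositive_transpose_kraus Psi_decomposition[OF assms]
  by blast

text \<open>
  For \<open>T = 0\<close> the transposed Kraus summand is diagonal, hence invariant under transposition.
\<close>

lemma completely_positive_Psi:
  assumes "0 \<le> R" "R \<le> 1"
  shows "completely_positive 3 (Psi 1 1 R 0)"
proof (rule completely_positive_cong)
  show "completely_positive 3 (\<lambda>X. Psi_cp R 0 X + kraus 3 (diag_op [0, 1, 0]) X)"
    by (intro completely_positive_add completely_positive_Psi_cp completely_positive_kraus)
  fix X :: "complex mat"
  have "transpose_mat (kraus 3 (diag_op [0, 1, 0]) X) = kraus 3 (diag_op [0, 1, 0]) X"
    by (rule eq_mat_3) (simp_all add: kraus_def diag_op_def sum3)
  then show "Psi_cp R 0 X + kraus 3 (diag_op [0, 1, 0]) X = Psi 1 1 R 0 X"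
    using Psi_decomposition[of R 0 X] assms by (simp add: power_le_one)
qed

text \<open>
  For \<open>R = 0\<close> the completely positive part is diagonal, so that transposing \<open>Psi\<close> only removes the
  transposition from the other summand.
\<close>

lemma completely_copositive_Psi:
  assumes "0 \<le> T" "T \<le> 1"
  shows "completely_copositive 3 (Psi 1 1 0 T)"
  unfolding completely_copositive_def
proof (rule completely_positive_cong)
  let ?W = "kraus 3 (diag_op [0, 1, of_real T])"
  show "completely_positive 3 (\<lambda>X. Psi_cp 0 T X + ?W X)"
    by (intro completely_positive_add completely_positive_Psi_cp completely_positive_kraus)
  fix X :: "complex mat"
  have car: "Psi_cp 0 T X \<in> carrier_mat 3 3" "transpose_mat (?W X) \<in> carrier_mat 3 3"
    unfolding Psi_cp_def kraus_def by simp_all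
  have "transpose_mat (Psi_cp 0 T X) = Psi_cp 0 T X"
    by (rule eq_mat_3) (simp_all add: Psi_cp_def kraus_def diag_op_def unit_op_def sum3)
  then show "Psi_cp 0 T X + ?W X = (transpose_mat \<circ> Psi 1 1 0 T) X"
    using Psi_decomposition[of 0 T X] assms transpose_add[OF car] by (simp add: power_le_one)
qed

section \<open>Obstructions to positivity and to decompositions\<close>

text \<open>
  Write \<open>f i a\<close> and \<open>g i a\<close> for the diagonal entries that the two summands contribute to \<open>\<Psi>(E\<^sub>i\<^sub>i)\<close>. They
  are nonnegative, so both vanish wherever \<open>\<Psi>(E\<^sub>i\<^sub>i)\<close> has a zero on the diagonal. Such a zero forces the
  copositive summand to contribute nothing to the entry \<open>R\<close>, and the positive summand nothing to the
  entry \<open>T\<close>. The remaining summand carries each entry alone, which costs it at least \<open>R\<^sup>2\<close>, respectively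
  \<open>T\<^sup>2\<close>, of its share of the last diagonal entry of \<open>\<Psi>(E\<^sub>3\<^sub>3)\<close>, and the two shares add up to \<open>1\<close>.
\<close>

lemma two_positive_two_copositive_sum_bound:
  assumes \<Phi>1: "k_positive 2 3 \<Phi>\<^sub>1" and \<Phi>2: "k_copositive 2 3 \<Phi>\<^sub>2"
    and sum: "\<And>X. X \<in> carrier_mat 3 3 \<Longrightarrow> Psi 1 1 R T X = \<Phi>\<^sub>1 X + \<Phi>\<^sub>2 X"
  shows "R\<^sup>2 + T\<^sup>2 \<le> 1"
proof -
  let ?E = "mat_unit 3"
  have E: "?E i j \<in> carrier_mat 3 3" for i j unfolding mat_unit_def by simp
  have "\<Phi>\<^sub>2 X \<in> carrier_mat 3 3" if "X \<in> carrier_mat 3 3" for X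
  proof -
    have "(transpose_mat \<circ> \<Phi>\<^sub>2) X \<in> carrier_mat 3 3"
      using \<Phi>2 that unfolding k_copositive_def k_positive_def mat_linear_def by blast
    then show ?thesis by simp
  qed
  then have ent: "Psi 1 1 R T (?E i j) $$ (a, b) = \<Phi>\<^sub>1 (?E i j) $$ (a, b) + \<Phi>\<^sub>2 (?E i j) $$ (a, b)"
    if "a < 3" "b < 3" for i j a b
    using sum[OF E] carrier_matD[of "\<Phi>\<^sub>2 (?E i j)" 3 3] E that by simp
  define f g where fg: "f i a = Re (\<Phi>\<^sub>1 (?E i i) $$ (a, a))" "g i a = Re (\<Phi>\<^sub>2 (?E i i) $$ (a, a))" for i a
  have nn: "0 \<le> f i a" "0 \<le> g i a" if "i < 3" "a < 3" for i a
    using two_positive_minor(2)[OF \<Phi>1] two_copositive_minor(2)[OF \<Phi>2] that unfolding fg by blast+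
  have diag: "f i a + g i a = Re (Psi 1 1 R T (?E i i) $$ (a, a))" if "i < 3" "a < 3" for i a
    using ent[of a a i i] that unfolding fg by simp
  have "f 0 0 + g 0 0 = 1" "f 0 2 + g 0 2 = 0" "f 1 1 + g 1 1 = 1" "f 2 1 + g 2 1 = 0" "f 2 2 + g 2 2 = 1"
    "f 2 0 + g 2 0 = 0"
    by (subst diag; simp add: Psi_index[simplified] mat_unit_def)+
  with nn[of 0 0] nn[of 0 2] nn[of 1 1] nn[of 2 1] nn[of 2 2] nn[of 2 0]
  have d: "f 0 0 \<le> 1" "g 0 2 = 0" "g 1 1 \<le> 1" "f 2 1 = 0" "f 2 2 + g 2 2 = 1" "0 \<le> f 2 2" "0 \<le> g 2 2"
    by auto
  have "\<Phi>\<^sub>2 (?E 0 2) $$ (0, 2) = 0"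
    using two_copositive_minor(1)[OF \<Phi>2, of 0 2 2 0] d(2) unfolding fg by simp
  then have "\<Phi>\<^sub>1 (?E 0 2) $$ (0, 2) = of_real R"
    using ent[of 0 2 0 2] by (simp add: Psi_index mat_unit_def)
  then have "R\<^sup>2 \<le> f 0 0 * f 2 2"
    using two_positive_minor(1)[OF \<Phi>1, of 0 2 0 2] unfolding fg by simp
  also have "\<dots> \<le> f 2 2" using d by (simp add: mult_left_le_one_le nn)
  finally have R: "R\<^sup>2 \<le> f 2 2" .
  have "\<Phi>\<^sub>1 (?E 2 1) $$ (1, 2) = 0"
    using two_positive_minor(1)[OF \<Phi>1, of 2 1 1 2] d(4) unfolding fg by simp
  then have "\<Phi>\<^sub>2 (?E 2 1) $$ (1, 2) = of_real T"
    using ent[of 1 2 2 1] by (simp add: Psi_index[simplified] mat_unit_def)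
  then have "T\<^sup>2 \<le> g 2 2 * g 1 1"
    using two_copositive_minor(1)[OF \<Phi>2, of 2 1 2 1] unfolding fg by simp
  also have "\<dots> \<le> g 2 2" using d by (simp add: mult_left_le nn)
  finally show ?thesis using R d by linarith
qed

text \<open>
  The entry \<open>T\<close> of the image of a matrix unit faces a zero diagonal entry of \<open>\<Psi>(E\<^sub>3\<^sub>3)\<close>, whereas \<open>R\<close>
  faces two diagonal entries equal to \<open>1\<close>. For 2-copositivity the two roles are exchanged.
\<close>

lemma two_positive_Psi_bounds:
  assumes "k_positive 2 3 (Psi 1 1 R T)"
  shows "T = 0" "\<bar>R\<bar> \<le> 1"
proof -
  show "T = 0"
    using two_positive_minor(1)[OF assms, of 2 1 1 2]
    by (simp add: Psi_index[simplified] mat_unit_def)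
  show "\<bar>R\<bar> \<le> 1"
    using two_positive_minor(1)[OF assms, of 0 2 0 2]
    by (simp add: Psi_index[simplified] mat_unit_def abs_square_le_1)
qed

lemma two_copositive_Psi_bounds:
  assumes "k_copositive 2 3 (Psi 1 1 R T)"
  shows "R = 0" "\<bar>T\<bar> \<le> 1"
proof -
  show "R = 0"
    using two_copositive_minor(1)[OF assms, of 0 2 2 0]
    by (simp add: Psi_index[simplified] mat_unit_def)
  show "\<bar>T\<bar> \<le> 1"
    using two_copositive_minor(1)[OF assms, of 2 1 2 1]
    by (simp add: Psi_index[simplified] mat_unit_def abs_square_le_1)
qed

lemma completely_positive_imp_two_positive: "completely_positive n \<Phi> \<Longrightarrow> k_positive 2 n \<Phi>"
  unfolding completely_positive_def by simp

lemma completely_copositive_imp_two_copositive: "completely_copositive n \<Phi> \<Longrightarrow> k_copositive 2 n \<Phi>"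
  unfolding completely_copositive_def k_copositive_def by (rule completely_positive_imp_two_positive)

theorem corollary3p6:
  shows "{(R, T). 0 \<le> R \<and> 0 \<le> T \<and> positive_map 3 (Psi 1 1 R T)}
           = {(R, T). 0 \<le> R \<and> R \<le> 1 \<and> 0 \<le> T \<and> T \<le> 1}
    \<and> {(R, T). 0 \<le> R \<and> 0 \<le> T \<and> decomposable 3 (Psi 1 1 R T)}
           = {(R, T). 0 \<le> R \<and> 0 \<le> T \<and> R\<^sup>2 + T\<^sup>2 \<le> 1}
    \<and> (\<forall>R T. 0 \<le> R \<and> R \<le> 1 \<and> 0 \<le> T \<and> T \<le> 1 \<and> R\<^sup>2 + T\<^sup>2 > 1
           \<longrightarrow> atomic 3 (Psi 1 1 R T))
    \<and> {(R, T). 0 \<le> R \<and> 0 \<le> T \<and> completely_positive 3 (Psi 1 1 R T)}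
           = {(R, T). 0 \<le> R \<and> R \<le> 1 \<and> T = 0}
    \<and> {(R, T). 0 \<le> R \<and> 0 \<le> T \<and> completely_copositive 3 (Psi 1 1 R T)}
           = {(R, T). R = 0 \<and> 0 \<le> T \<and> T \<le> 1}"
proof (intro conjI)
  show "{(R, T). 0 \<le> R \<and> 0 \<le> T \<and> positive_map 3 (Psi 1 1 R T)}
           = {(R, T). 0 \<le> R \<and> R \<le> 1 \<and> 0 \<le> T \<and> T \<le> 1}"
    using positive_Psi positive_Psi_bounds by force
  have "R\<^sup>2 + T\<^sup>2 \<le> 1" if "decomposable 3 (Psi 1 1 R T)" for R T
    using that two_positive_two_copositive_sum_bound completely_positive_imp_two_positive
      completely_copositive_imp_two_copositive unfolding decomposable_def by metis
  then show "{(R, T). 0 \<le> R \<and> 0 \<le> T \<and> decomposable 3 (Psi 1 1 R T)}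
           = {(R, T). 0 \<le> R \<and> 0 \<le> T \<and> R\<^sup>2 + T\<^sup>2 \<le> 1}"
    using decomposable_Psi by blast
  show "\<forall>R T. 0 \<le> R \<and> R \<le> 1 \<and> 0 \<le> T \<and> T \<le> 1 \<and> R\<^sup>2 + T\<^sup>2 > 1 \<longrightarrow> atomic 3 (Psi 1 1 R T)"
    unfolding atomic_def using positive_Psi two_positive_two_copositive_sum_bound
    by (metis not_le)
  show "{(R, T). 0 \<le> R \<and> 0 \<le> T \<and> completely_positive 3 (Psi 1 1 R T)}
           = {(R, T). 0 \<le> R \<and> R \<le> 1 \<and> T = 0}"
    using completely_positive_Psi two_positive_Psi_bounds[OF completely_positive_imp_two_positive]
    by (force simp: abs_le_iff)
  show "{(R, T). 0 \<le> R \<and> 0 \<le> T \<and> completely_copositive 3 (Psi 1 1 R T)}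
           = {(R, T). R = 0 \<and> 0 \<le> T \<and> T \<le> 1}"
    using completely_copositive_Psi two_copositive_Psi_bounds[OF completely_copositive_imp_two_copositive]
    by (force simp: abs_le_iff)
qed

end
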